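(* The poset reflections (quotients by the induced equivalence) of the following two preorders are isomorphic: (i) the class of bilayer functions preordered by one-query bilayered Turing reducibility $\le^1_{LT}$; (ii) the set of computably monotone functions $\Omega\to\Omega$ preordered by $\le_{\rm rea}$.
   Context: A bilayer function is a partial multi-valued function $g\colon\subseteq\mathbb{N}\times\Lambda\rightrightarrows\mathbb{N}$ for some set $\Lambda$; arguments are written $(n\mid c)$ ($n$ public, $c$ secret input). For bilayer functions $f,g$, $f\le^1_{LT}g$ iff there are partial computable functions $H,K$ and an arbitrary function $L$ such that for all $(n\mid c)\in\mathrm{dom}(f)$: $(H(n)\mid L(n,c))\in\mathrm{dom}(g)$ and for every $m\in g(H(n)\mid L(n,c))$, $K(n,m)\in f(n\mid c)$. $\Omega=\mathcal{P}(\mathbb{N})$; $\varphi_e$ is the $e$-th partial computable function; for $p,q\in\Omega$, $p\to q=\{e:\forall n\in p\;\varphi_e(n)\downarrow\in q\}$. A function $\beta\colon\Omega\to\Omega$ is computably monotone if there is $e$ such that for all $p,q\in\Omega$ and all $a\in(p\to q)$, $\varphi_e(a)\downarrow\in(\beta(p)\to\beta(q))$. For $\alpha,\beta\colon\Omega\to\Omega$, $\alpha\le_{\rm rea}\beta$ iff there is $e$ with $e\in(\alpha(p)\to\beta(p))$ for every $p\in\Omega$. *)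

theory Defs
  imports Complex_Main "HOL-Library.Nat_Bijection"
begin

section \<open>Partial computable functions and their enumeration\<close>

text \<open>
  Programs for the partial recursive functions \<^typ>\<open>nat \<rightharpoonup> nat\<close>. Several arguments are passed through
  the Cantor pairing \<^const>\<open>prod_encode\<close>, so that no arities are needed; \<open>Pr\<close> is primitive
  recursion on the second component and \<open>Mn\<close> is unbounded minimisation.
\<close>

datatype program =
    Zero
  | Succ
  | Fst
  | Snd
  | Pairing program program
  | Comp program program
  | Pr program program
  | Mn program

primrec run :: "program \<Rightarrow> nat \<rightharpoonup> nat" where
  "run Zero = (\<lambda>x. Some 0)"
| "run Succ = (\<lambda>x. Some (Suc x))"
| "run Fst = (\<lambda>x. Some (fst (prod_decode x)))"
| "run Snd = (\<lambda>x. Some (snd (prod_decode x)))"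
| "run (Pairing s t) =
     (\<lambda>x. Option.bind (run s x) (\<lambda>y. Option.bind (run t x) (\<lambda>z. Some (prod_encode (y, z)))))"
| "run (Comp s t) = (\<lambda>x. Option.bind (run t x) (run s))"
| "run (Pr s t) =
     (\<lambda>x. rec_nat (run s (fst (prod_decode x)))
            (\<lambda>i r. Option.bind r
               (\<lambda>y. run t (prod_encode (fst (prod_decode x), prod_encode (i, y)))))
            (snd (prod_decode x)))"
| "run (Mn s) =
     (\<lambda>x. if \<exists>k. run s (prod_encode (x, k)) = Some 0
                  \<and> (\<forall>i<k. run s (prod_encode (x, i)) \<noteq> None)
          then Some (LEAST k. run s (prod_encode (x, k)) = Some 0)
          else None)"

primrec goedel :: "program \<Rightarrow> nat" where
  "goedel Zero = prod_encode (0, 0)"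
| "goedel Succ = prod_encode (1, 0)"
| "goedel Fst = prod_encode (2, 0)"
| "goedel Snd = prod_encode (3, 0)"
| "goedel (Pairing s t) = prod_encode (4, prod_encode (goedel s, goedel t))"
| "goedel (Comp s t) = prod_encode (5, prod_encode (goedel s, goedel t))"
| "goedel (Pr s t) = prod_encode (6, prod_encode (goedel s, goedel t))"
| "goedel (Mn s) = prod_encode (7, goedel s)"

lemma goedel_inject: "goedel s = goedel t \<longleftrightarrow> s = t"
  by (induction s arbitrary: t; case_tac t) (simp_all add: prod_encode_eq)

text \<open>Numbers that are not the Goedel number of a program index the nowhere defined function.\<close>

definition phi :: "nat \<Rightarrow> nat \<rightharpoonup> nat" where
  "phi e = (if e \<in> range goedel then run (inv goedel e) else Map.empty)"

lemma phi_goedel: "phi (goedel s) = run s"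
proof -
  have "inj goedel"
    by (simp add: inj_def goedel_inject)
  then show ?thesis
    by (simp add: phi_def inv_f_f)
qed

definition partial_computable :: "(nat \<rightharpoonup> nat) \<Rightarrow> bool" where
  "partial_computable F \<longleftrightarrow> (\<exists>e. F = phi e)"

definition partial_computable2 :: "(nat \<Rightarrow> nat \<rightharpoonup> nat) \<Rightarrow> bool" where
  "partial_computable2 F \<longleftrightarrow> (\<exists>G. partial_computable G \<and> (\<forall>n m. F n m = G (prod_encode (n, m))))"

section \<open>Bilayer functions\<close>

text \<open>
  A partial multi-valued function is a partial function into the power set: an argument in the
  domain may have an empty set of values, and is then different from an argument outside the domain.
  The set \<open>\<Lambda>\<close> of secret inputs is any subset of the type \<open>'l\<close>, which
  plays the role of the ambient universe. The reducibility \<open>le_LT1\<close> below compares bilayer functions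
  over different universes, so that one can also say that a given universe represents every bilayer
  function up to equivalence. A universe needs a copy of \<^typ>\<open>nat set\<close> for that.
\<close>

record 'l bilayer =
  secrets :: "'l set"
  values_at :: "nat \<times> 'l \<rightharpoonup> nat set"

definition bilayer_functions :: "'l bilayer set" where
  "bilayer_functions = {g. dom (values_at g) \<subseteq> UNIV \<times> secrets g}"

definition le_LT1 :: "'l bilayer \<Rightarrow> 'm bilayer \<Rightarrow> bool" where
  "le_LT1 f g \<longleftrightarrow>
     (\<exists>H K. \<exists>L :: nat \<Rightarrow> 'l \<Rightarrow> 'm. partial_computable H \<and> partial_computable2 K \<and>
        (\<forall>n c. (n, c) \<in> dom (values_at f) \<longrightarrow>
           (\<exists>h. H n = Some h \<and> (h, L n c) \<in> dom (values_at g) \<and>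
              (\<forall>m \<in> the (values_at g (h, L n c)). \<exists>k \<in> the (values_at f (n, c)). K n m = Some k))))"

section \<open>Computably monotone functions on the power set of the natural numbers\<close>

definition imp :: "nat set \<Rightarrow> nat set \<Rightarrow> nat set" where
  "imp p q = {e. \<forall>n\<in>p. \<exists>m\<in>q. phi e n = Some m}"

definition computably_monotone :: "(nat set \<Rightarrow> nat set) \<Rightarrow> bool" where
  "computably_monotone \<beta> \<longleftrightarrow>
     (\<exists>e. \<forall>p q. \<forall>a \<in> imp p q. \<exists>b \<in> imp (\<beta> p) (\<beta> q). phi e a = Some b)"

definition le_rea :: "(nat set \<Rightarrow> nat set) \<Rightarrow> (nat set \<Rightarrow> nat set) \<Rightarrow> bool" where
  "le_rea \<alpha> \<beta> \<longleftrightarrow> (\<exists>e. \<forall>p. e \<in> imp (\<alpha> p) (\<beta> p))"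

section \<open>Poset reflections\<close>

definition induced_equiv :: "'a set \<Rightarrow> ('a \<Rightarrow> 'a \<Rightarrow> bool) \<Rightarrow> 'a rel" where
  "induced_equiv A le = {(x, y). x \<in> A \<and> y \<in> A \<and> le x y \<and> le y x}"

definition reflection :: "'a set \<Rightarrow> ('a \<Rightarrow> 'a \<Rightarrow> bool) \<Rightarrow> 'a set set" where
  "reflection A le = A // induced_equiv A le"

definition reflection_le :: "('a \<Rightarrow> 'a \<Rightarrow> bool) \<Rightarrow> 'a set \<Rightarrow> 'a set \<Rightarrow> bool" where
  "reflection_le le X Y \<longleftrightarrow> (\<exists>x\<in>X. \<exists>y\<in>Y. le x y)"

definition poset_isomorphic ::
  "'a set \<Rightarrow> ('a \<Rightarrow> 'a \<Rightarrow> bool) \<Rightarrow> 'b set \<Rightarrow> ('b \<Rightarrow> 'b \<Rightarrow> bool) \<Rightarrow> bool" where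
  "poset_isomorphic A le B le' \<longleftrightarrow>
     (\<exists>h. bij_betw h A B \<and> (\<forall>x\<in>A. \<forall>y\<in>A. le x y \<longleftrightarrow> le' (h x) (h y)))"

end

theory Submission
  imports Defs
begin

text \<open>
  A bilayer function \<open>g\<close> is sent to the operator whose value at \<open>p\<close> consists of all pairs \<open>\<langle>h, e\<rangle>\<close>
  such that, for some secret input \<open>c\<close>, the program \<open>e\<close> maps \<open>g(h | c)\<close> into \<open>p\<close>. A realizer of the
  inequality of two such operators, applied to \<open>\<langle>n, id\<rangle>\<close> at \<open>p = f(n | c)\<close>, yields a query to \<open>g\<close>
  together with a program that transforms every answer into a value of \<open>f(n | c)\<close>; so the
  assignment reflects the order. Conversely, a computably monotone \<open>\<beta>\<close> comes from the bilayer
  function that has the secret inputs \<open>q \<subseteq> \<nat>\<close>, is defined at \<open>(n | q)\<close> if \<open>n \<in> \<beta> q\<close>, and then has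
  the value \<open>q\<close>. Both steps run a program found by computation, hence need a universal program;
  it is obtained by searching for the halting time of a stack machine.
\<close>

section \<open>Total computable functions\<close>

abbreviation pair :: "nat \<Rightarrow> nat \<Rightarrow> nat" where
  "pair x y \<equiv> prod_encode (x, y)"

abbreviation pr1 :: "nat \<Rightarrow> nat" where
  "pr1 x \<equiv> fst (prod_decode x)"

abbreviation pr2 :: "nat \<Rightarrow> nat" where
  "pr2 x \<equiv> snd (prod_decode x)"

definition total_computable :: "(nat \<Rightarrow> nat) \<Rightarrow> bool" where
  "total_computable F \<longleftrightarrow> (\<exists>s. \<forall>x. run s x = Some (F x))"

lemma total_computableI: "(\<And>x. run s x = Some (F x)) \<Longrightarrow> total_computable F"
  by (auto simp: total_computable_def)

text \<open>There is no identity constructor in \<open>program\<close>; taking a Cantor pair apart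
  and pairing it again serves as one, here and below.\<close>

lemma total_computable_id: "total_computable (\<lambda>x. x)"
  by (rule total_computableI[of "Pairing Fst Snd"]) simp

lemma total_computable_comp:
  assumes "total_computable f" "total_computable g"
  shows "total_computable (\<lambda>x. f (g x))"
proof -
  obtain s t where "\<forall>x. run s x = Some (f x)" "\<forall>x. run t x = Some (g x)"
    using assms by (auto simp: total_computable_def)
  then show ?thesis
    by (intro total_computableI[of "Comp s t"]) simp
qed

lemma total_computable_Suc: "total_computable f \<Longrightarrow> total_computable (\<lambda>x. Suc (f x))"
  by (rule total_computable_comp, rule total_computableI[of Succ]) auto

lemma total_computable_pr1: "total_computable f \<Longrightarrow> total_computable (\<lambda>x. pr1 (f x))"
  by (rule total_computable_comp[of pr1], rule total_computableI[of Fst]) auto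

lemma total_computable_pr2: "total_computable f \<Longrightarrow> total_computable (\<lambda>x. pr2 (f x))"
  by (rule total_computable_comp[of pr2], rule total_computableI[of Snd]) auto

lemma total_computable_pair:
  assumes "total_computable f" "total_computable g"
  shows "total_computable (\<lambda>x. pair (f x) (g x))"
proof -
  obtain s t where "\<forall>x. run s x = Some (f x)" "\<forall>x. run t x = Some (g x)"
    using assms by (auto simp: total_computable_def)
  then show ?thesis
    by (intro total_computableI[of "Pairing s t"]) simp
qed

lemma total_computable_const: "total_computable (\<lambda>_. k)"
  by (induction k) (auto intro: total_computable_Suc total_computableI[of Zero])

lemmas total_computable_basic =
  total_computable_id total_computable_const total_computable_Suc
  total_computable_pr1 total_computable_pr2 total_computable_pair

section \<open>Closure under recursion, subtraction and case distinction\<close>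

lemma total_computable_rec_nat:
  assumes "total_computable f" "total_computable g" "total_computable h"
  shows "total_computable (\<lambda>x. rec_nat (f x) (\<lambda>i r. g (pair x (pair i r))) (h x))"
proof -
  obtain s t where st: "\<forall>x. run s x = Some (f x)" "\<forall>x. run t x = Some (g x)"
    using assms by (auto simp: total_computable_def)
  have "rec_nat (run s x) (\<lambda>i r. Option.bind r (\<lambda>y. run t (pair x (pair i y)))) n
      = Some (rec_nat (f x) (\<lambda>i r. g (pair x (pair i r))) n)" for x n
    by (induction n) (simp_all add: st)
  then have "total_computable
      (\<lambda>z. rec_nat (f (pr1 z)) (\<lambda>i r. g (pair (pr1 z) (pair i r))) (pr2 z))"
    by (intro total_computableI[of "Pr s t"]) simp
  from total_computable_comp[OF this
      total_computable_pair[OF total_computable_id assms(3)]]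
  show ?thesis
    by simp
qed

lemma total_computable_funpow:
  assumes "total_computable g" "total_computable f" "total_computable h"
  shows "total_computable (\<lambda>x. (g ^^ h x) (f x))"
proof -
  have "rec_nat a (\<lambda>_. g) n = (g ^^ n) a" for a n
    by (induction n) simp_all
  moreover have "total_computable (\<lambda>x. g (pr2 (pr2 x)))"
    by (intro total_computable_comp[OF assms(1)] total_computable_basic)
  ultimately show ?thesis
    using total_computable_rec_nat[OF assms(2) _ assms(3), of "\<lambda>x. g (pr2 (pr2 x))"] by simp
qed

lemma total_computable_diff:
  assumes "total_computable f" "total_computable g"
  shows "total_computable (\<lambda>x. f x - g x)"
proof -
  \<comment> \<open>Recursion that returns its counter is the predecessor; iterating that yields
    truncated subtraction.\<close>
  have "rec_nat 0 (\<lambda>i _. i) n = n - 1" for n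
    by (cases n) simp_all
  then have "total_computable (\<lambda>n. n - 1)"
    using total_computable_rec_nat[of "\<lambda>_. 0" "\<lambda>x. pr1 (pr2 x)" "\<lambda>x. x"]
    by (simp add: total_computable_basic)
  moreover have "((\<lambda>n. n - 1) ^^ k) a = a - k" for a k :: nat
    by (induction k) simp_all
  ultimately show ?thesis
    using total_computable_funpow[of "\<lambda>n. n - 1" f g] assms by simp
qed

lemma total_computable_if_0:
  assumes "total_computable c" "total_computable f" "total_computable g"
  shows "total_computable (\<lambda>x. if c x = 0 then f x else g x)"
proof -
  have "rec_nat a (\<lambda>_ _. b) n = (if n = 0 then a else b)" for a b n :: nat
    by (cases n) simp_all
  moreover have "total_computable (\<lambda>x. g (pr1 x))"
    by (intro total_computable_comp[OF assms(3)] total_computable_basic)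
  ultimately show ?thesis
    using total_computable_rec_nat[OF assms(2) _ assms(1), of "\<lambda>x. g (pr1 x)"] by simp
qed

lemma total_computable_if_eq:
  assumes "total_computable c" "total_computable d" "total_computable f" "total_computable g"
  shows "total_computable (\<lambda>x. if c x = d x then f x else g x)"
proof -
  \<comment> \<open>Two natural numbers are equal iff both truncated differences vanish.\<close>
  have "(\<lambda>x. if c x = d x then f x else g x) =
      (\<lambda>x. if c x - d x = 0 then if d x - c x = 0 then f x else g x else g x)"
    by auto
  then show ?thesis
    by (simp only:) (intro total_computable_if_0 total_computable_diff assms)
qed

section \<open>A universal program\<close>

text \<open>
  A state \<open>\<langle>\<langle>i, k\<rangle>, v\<rangle>\<close> consists of the current instruction \<open>i\<close>, the stack \<open>k\<close> of further
  instructions and the current value \<open>v\<close>. Instructions are Goedel numbers of programs, together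
  with frames for pending computations: \<open>\<langle>8, \<langle>t, x\<rangle>\<rangle>\<close> and \<open>\<langle>9, y\<rangle>\<close> for \<^const>\<open>Pairing\<close>,
  \<open>\<langle>10, \<langle>t, \<langle>x, \<langle>i, n\<rangle>\<rangle>\<rangle>\<rangle>\<close> for \<^const>\<open>Pr\<close> and \<open>\<langle>11, \<langle>s, \<langle>x, k\<rangle>\<rangle>\<rangle>\<close> for \<^const>\<open>Mn\<close>. All tags
  from \<open>12\<close> on halt.
\<close>

definition exec :: "nat \<Rightarrow> nat \<Rightarrow> nat \<Rightarrow> nat \<Rightarrow> nat" where
  "exec i a k v =
    (if i = 0 then pair k 0
     else if i = 1 then pair k (Suc v)
     else if i = 2 then pair k (pr1 v)
     else if i = 3 then pair k (pr2 v)
     else if i = 4 then pair (pair (pr1 a) (pair (pair 8 (pair (pr2 a) v)) k)) v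
     else if i = 5 then pair (pair (pr2 a) (pair (pr1 a) k)) v
     else if i = 6 then
       pair (pair (pr1 a)
         (pair (pair 10 (pair (pr2 a) (pair (pr1 v) (pair 0 (pr2 v))))) k)) (pr1 v)
     else if i = 7 then pair (pair a (pair (pair 11 (pair a (pair v 0))) k)) (pair v 0)
     else if i = 8 then pair (pair (pr1 a) (pair (pair 9 v) k)) (pr2 a)
     else if i = 9 then pair k (pair a v)
     else if i = 10 then
       (if pr1 (pr2 (pr2 a)) = pr2 (pr2 (pr2 a)) then pair k v
        else pair (pair (pr1 a)
          (pair (pair 10 (pair (pr1 a) (pair (pr1 (pr2 a))
            (pair (Suc (pr1 (pr2 (pr2 a)))) (pr2 (pr2 (pr2 a))))))) k))
          (pair (pr1 (pr2 a)) (pair (pr1 (pr2 (pr2 a))) v)))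
     else if i = 11 then
       (if v = 0 then pair k (pr2 (pr2 a))
        else pair (pair (pr1 a)
          (pair (pair 11 (pair (pr1 a) (pair (pr1 (pr2 a)) (Suc (pr2 (pr2 a)))))) k))
          (pair (pr1 (pr2 a)) (Suc (pr2 (pr2 a)))))
     else pair (pair (pair i a) k) v)"

definition step :: "nat \<Rightarrow> nat" where
  "step z = exec (pr1 (pr1 (pr1 z))) (pr2 (pr1 (pr1 z))) (pr2 (pr1 z)) (pr2 z)"

lemma total_computable_step: "total_computable step"
  unfolding step_def[abs_def] exec_def
  by (intro total_computable_if_eq total_computable_basic)

lemma step_pair [simp]: "step (pair (pair (pair i a) k) v) = exec i a k v"
  by (simp add: step_def)

section \<open>Correctness of the stack machine\<close>

definition reaches :: "nat \<Rightarrow> nat \<Rightarrow> bool" where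
  "reaches x y \<longleftrightarrow> (\<exists>n. (step ^^ n) x = y)"

lemma reaches_refl: "reaches x x"
  unfolding reaches_def by (rule exI[of _ 0]) simp

lemma reaches_trans:
  assumes "reaches x y" "reaches y z"
  shows "reaches x z"
proof -
  obtain m n where "(step ^^ m) x = y" "(step ^^ n) y = z"
    using assms by (auto simp: reaches_def)
  then have "(step ^^ (n + m)) x = z"
    by (simp add: funpow_add)
  then show ?thesis
    unfolding reaches_def ..
qed

lemma reaches_step: "reaches (step x) y \<Longrightarrow> reaches x y"
  using reaches_trans[of x "step x" y] unfolding reaches_def
  by (metis funpow_0 funpow_simps_right(2) o_apply)

text \<open>Induction on the number \<open>d\<close> of remaining rounds: the frame stores the
  counter \<open>i\<close> and the fixed bound \<open>i + d\<close>, and pops when they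
  agree.\<close>

lemma reaches_Pr_loop:
  assumes t: "\<And>x y k. run t x = Some y \<Longrightarrow> reaches (pair (pair (goedel t) k) x) (pair k y)"
    and "rec_nat r (\<lambda>i r. Option.bind r (\<lambda>y. run t (pair x (pair i y)))) (i + d) = Some z"
    and "rec_nat r (\<lambda>i r. Option.bind r (\<lambda>y. run t (pair x (pair i y)))) i = Some y"
  shows "reaches (pair (pair (pair 10 (pair (goedel t) (pair x (pair i (i + d))))) k) y) (pair k z)"
  using assms(2,3)
proof (induction d arbitrary: i y)
  case 0
  then show ?case
    by (intro reaches_step[of "pair _ _"]) (simp add: exec_def reaches_refl)
next
  case (Suc d)
  let ?R = "rec_nat r (\<lambda>i r. Option.bind r (\<lambda>y. run t (pair x (pair i y))))"
  have "?R (Suc i + d) = Some z"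
    using Suc.prems(1) by simp
  \<comment> \<open>\<open>None\<close> is absorbing under \<open>Option.bind\<close>, so a
    recursion that is defined at the bound is defined at every earlier stage.\<close>
  moreover have "?R (Suc i) \<noteq> None"
  proof
    assume "?R (Suc i) = None"
    then have "?R (Suc i + m) = None" for m
      by (induction m) simp_all
    with \<open>?R (Suc i + d) = Some z\<close> show False
      by (metis option.distinct(1))
  qed
  then obtain y' where y': "?R (Suc i) = Some y'"
    by blast
  ultimately have "reaches (pair (pair (pair 10
      (pair (goedel t) (pair x (pair (Suc i) (Suc i + d))))) k) y') (pair k z)"
    by (rule Suc.IH)
  moreover have "run t (pair x (pair i y)) = Some y'"
    using y' Suc.prems(2) by simp
  note t[OF this]
  ultimately have "reaches (pair (pair (goedel t) (pair (pair 10
      (pair (goedel t) (pair x (pair (Suc i) (Suc i + d))))) k)) (pair x (pair i y))) (pair k z)"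
    using reaches_trans by blast
  then show ?case
    by (intro reaches_step[of "pair (pair (pair 10 _) _) _"]) (simp add: exec_def)
qed

text \<open>Induction on the distance \<open>d\<close> from the candidate \<open>j\<close> to the
  zero \<open>m\<close>: each earlier candidate yields a successor, upon which the frame starts the
  next one.\<close>

lemma reaches_Mn_loop:
  assumes s: "\<And>x y k. run s x = Some y \<Longrightarrow> reaches (pair (pair (goedel s) k) x) (pair k y)"
    and least: "run s (pair x m) = Some 0" "\<And>j. j < m \<Longrightarrow> \<exists>v. run s (pair x j) = Some (Suc v)"
    and "j + d = m"
  shows "reaches (pair (pair (goedel s) (pair (pair 11 (pair (goedel s) (pair x j))) k)) (pair x j))
    (pair k m)"
  using assms(4)
proof (induction d arbitrary: j)
  case 0
  have "reaches (pair (pair (pair 11 (pair (goedel s) (pair x m))) k) 0) (pair k m)"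
    by (rule reaches_step) (simp add: exec_def reaches_refl)
  with s[OF least(1)] 0 show ?case
    by (auto intro: reaches_trans)
next
  case (Suc d)
  obtain v where v: "run s (pair x j) = Some (Suc v)"
    using least(2)[of j] Suc.prems by auto
  have "reaches (pair (pair (pair 11 (pair (goedel s) (pair x j))) k) (Suc v)) (pair k m)"
    by (rule reaches_step) (use Suc in \<open>simp add: exec_def\<close>)
  with s[OF v] show ?case
    by (rule reaches_trans)
qed

text \<open>Structural induction; \<open>k\<close> has to be arbitrary because a compound program
  runs its parts on top of frames that it pushes onto the stack.\<close>

lemma reaches_run: "run s x = Some y \<Longrightarrow> reaches (pair (pair (goedel s) k) x) (pair k y)"
proof (induction s arbitrary: x y k)
  case (Pairing s t)
  then obtain u v where uv: "run s x = Some u" "run t x = Some v" "y = pair u v"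
    by (auto simp: bind_eq_Some_conv)
  have "reaches (pair (pair (pair 9 u) k) v) (pair k y)"
    by (rule reaches_step) (simp add: exec_def reaches_refl uv)
  with Pairing.IH(2)[OF uv(2)]
  have "reaches (pair (pair (goedel t) (pair (pair 9 u) k)) x) (pair k y)"
    by (rule reaches_trans)
  then have "reaches (pair (pair (pair 8 (pair (goedel t) x)) k) u) (pair k y)"
    by (intro reaches_step[of "pair (pair (pair 8 _) _) _"]) (simp add: exec_def)
  with Pairing.IH(1)[OF uv(1)]
  have "reaches (pair (pair (goedel s) (pair (pair 8 (pair (goedel t) x)) k)) x) (pair k y)"
    by (rule reaches_trans)
  then show ?case
    by (intro reaches_step[of "pair (pair (goedel (Pairing _ _)) _) _"]) (simp add: exec_def)
next
  case (Comp s t)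
  then obtain u where u: "run t x = Some u" "run s u = Some y"
    by (auto simp: bind_eq_Some_conv)
  have "reaches (pair (pair (goedel t) (pair (goedel s) k)) x) (pair k y)"
    by (rule reaches_trans[OF Comp.IH(2)[OF u(1)] Comp.IH(1)[OF u(2)]])
  then show ?case
    by (intro reaches_step[of "pair (pair (goedel (Comp _ _)) _) _"]) (simp add: exec_def)
next
  case (Pr s t)
  let ?R = "rec_nat (run s (pr1 x)) (\<lambda>i r. Option.bind r (\<lambda>y. run t (pair (pr1 x) (pair i y))))"
  have R: "?R (pr2 x) = Some y"
    using Pr.prems by simp
  have "run s (pr1 x) \<noteq> None"
  proof
    assume "run s (pr1 x) = None"
    then have "?R m = None" for m
      by (induction m) simp_all
    with R show False
      by (metis option.distinct(1))
  qed
  then obtain u where u: "run s (pr1 x) = Some u"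
    by blast
  have "reaches (pair (pair (pair 10 (pair (goedel t) (pair (pr1 x) (pair 0 (0 + pr2 x))))) k) u)
      (pair k y)"
    by (rule reaches_Pr_loop[where r = "run s (pr1 x)"]) (use Pr.IH(2) R u in auto)
  with Pr.IH(1)[OF u]
  have "reaches (pair (pair (goedel s)
      (pair (pair 10 (pair (goedel t) (pair (pr1 x) (pair 0 (pr2 x))))) k)) (pr1 x)) (pair k y)"
    by (auto intro: reaches_trans)
  then show ?case
    by (intro reaches_step[of "pair (pair (goedel (Pr _ _)) _) _"]) (simp add: exec_def)
next
  case (Mn s)
  \<comment> \<open>The least zero \<open>y\<close> is at most \<open>m\<close>, so all values
    before \<open>y\<close> are defined and, by minimality, nonzero.\<close>
  obtain m where m: "run s (pair x m) = Some 0" "\<And>i. i < m \<Longrightarrow> run s (pair x i) \<noteq> None"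
    and y: "y = (LEAST k. run s (pair x k) = Some 0)"
    using Mn.prems by (auto split: if_splits)
  have "run s (pair x y) = Some 0" "y \<le> m"
    unfolding y using m(1) by (auto intro: LeastI Least_le)
  moreover have "\<exists>v. run s (pair x j) = Some (Suc v)" if j: "j < y" for j
  proof -
    obtain w where "run s (pair x j) = Some w"
      using m(2)[of j] j \<open>y \<le> m\<close> by auto
    moreover have "w \<noteq> 0"
      using not_less_Least[OF j[unfolded y]] calculation by auto
    ultimately show ?thesis
      by (cases w) auto
  qed
  ultimately have "reaches (pair (pair (goedel s)
      (pair (pair 11 (pair (goedel s) (pair x 0))) k)) (pair x 0)) (pair k y)"
    by (intro reaches_Mn_loop[where d = y]) (use Mn.IH in auto)
  then show ?case
    by (intro reaches_step[of "pair (pair (goedel (Mn _)) _) _"]) (simp add: exec_def)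
qed (auto intro!: reaches_step[of "pair _ _"] simp: exec_def reaches_refl)

lemma phi_SomeE:
  assumes "phi e x = Some y"
  obtains s where "e = goedel s" "run s x = Some y"
  using assms phi_goedel by (auto simp: phi_def split: if_splits)

text \<open>
  The machine starts on top of the halting instruction \<open>\<langle>12, 0\<rangle>\<close>. As halting states are fixed
  points of \<^const>\<open>step\<close>, every halting time yields the same value as the least one.
\<close>

lemma universal_program:
  "\<exists>u. \<forall>e x y. phi e x = Some y \<longrightarrow> run u (pair e x) = Some y"
proof -
  define halt where "halt = pair (pair 12 0) 0"
  define T where "T z n = (step ^^ n) (pair (pair (pr1 z) halt) (pr2 z))" for z n
  have T: "total_computable (\<lambda>w. T (pr1 w) (pr2 w))"
    unfolding T_def by (intro total_computable_funpow total_computable_step total_computable_basic)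
  \<comment> \<open>\<open>Mn\<close> searches for a zero, so the test returns 0 exactly when only
    the halting instruction is left on the stack.\<close>
  have "total_computable (\<lambda>w. if pr1 (T (pr1 w) (pr2 w)) = halt then 0 else 1)"
    by (intro total_computable_if_eq total_computable_pr1 T total_computable_const)
  then obtain h where h: "\<And>w. run h w = Some (if pr1 (T (pr1 w) (pr2 w)) = halt then 0 else 1)"
    by (auto simp: total_computable_def)
  have "total_computable (\<lambda>w. pr2 (T (pr1 w) (pr2 w)))"
    by (intro total_computable_pr2 T)
  then obtain r where r: "\<And>w. run r w = Some (pr2 (T (pr1 w) (pr2 w)))"
    by (auto simp: total_computable_def)
  define u where "u = Comp r (Pairing (Pairing Fst Snd) (Mn h))"
  have "run u (pair e x) = Some y" if exy: "phi e x = Some y" for e x y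
  proof -
    let ?z = "pair e x"
    obtain s where s: "e = goedel s" "run s x = Some y"
      using exy by (rule phi_SomeE)
    have "reaches (pair (pair e halt) x) (pair halt y)"
      using reaches_run[OF s(2)] s(1) by simp
    then obtain n where n: "T ?z n = pair halt y"
      by (auto simp: reaches_def T_def)
    define m where "m = (LEAST m. pr1 (T ?z m) = halt)"
    have m: "pr1 (T ?z m) = halt" "m \<le> n"
      unfolding m_def by (rule LeastI[of _ n], simp add: n) (simp add: Least_le n)
    have fix_step: "step w = w" if "pr1 w = halt" for w
    proof -
      have "w = pair halt (pr2 w)"
        using that by (metis prod.collapse prod_decode_inverse)
      then show ?thesis
        using step_pair[of 12 0 0 "pr2 w"] by (simp add: halt_def exec_def)
    qed
    have "(step ^^ d) (T ?z m) = T ?z m" for d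
      by (induction d) (simp_all add: fix_step m(1))
    from this[of "n - m"] have "T ?z m = T ?z n"
      using m(2) unfolding T_def by (metis funpow_add le_add_diff_inverse2 o_apply)
    moreover have "run (Mn h) ?z = Some m"
    proof -
      have "(LEAST k. run h (pair ?z k) = Some 0) = m"
        by (simp add: h m_def)
      moreover have "run h (pair ?z n) = Some 0 \<and> (\<forall>i<n. run h (pair ?z i) \<noteq> None)"
        by (simp add: h n)
      ultimately show ?thesis
        by (auto simp del: split_paired_Ex)
    qed
    ultimately show ?thesis
      unfolding u_def using n by (simp add: r del: run.simps(8))
  qed
  then show ?thesis
    by blast
qed

section \<open>Indices\<close>

lemma partial_computable_iff: "partial_computable F \<longleftrightarrow> (\<exists>s. F = run s)"
proof
  assume "partial_computable F"
  then obtain e where e: "F = phi e"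
    by (auto simp: partial_computable_def)
  show "\<exists>s. F = run s"
  proof (cases "e \<in> range goedel")
    case True
    then show ?thesis
      using e phi_goedel by auto
  next
    case False
    \<comment> \<open>The search never meets a zero, so this program diverges everywhere.\<close>
    then have "F = run (Mn (Comp Succ Zero))"
      by (simp add: e phi_def)
    then show ?thesis ..
  qed
next
  assume "\<exists>s. F = run s"
  then show "partial_computable F"
    using phi_goedel by (metis partial_computable_def)
qed

definition id_index :: nat where
  "id_index = goedel (Pairing Fst Snd)"

lemma phi_id_index [simp]: "phi id_index x = Some x"
  by (simp add: id_index_def phi_goedel del: goedel.simps)

text \<open>This is the code of \<open>Comp\<close>, written on arbitrary numbers so that it is a
  total computable function of both indices.\<close>

definition comp_index :: "nat \<Rightarrow> nat \<Rightarrow> nat" where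
  "comp_index a b = pair 5 (pair a b)"

lemma phi_comp_index:
  assumes "phi b x = Some y" "phi a y = Some z"
  shows "phi (comp_index a b) x = Some z"
proof -
  obtain s t where "b = goedel t" "run t x = Some y" "a = goedel s" "run s y = Some z"
    using assms by (metis phi_SomeE)
  then show ?thesis
    using phi_goedel[of "Comp s t"] by (simp add: comp_index_def)
qed

primrec const_program :: "nat \<Rightarrow> program" where
  "const_program 0 = Zero"
| "const_program (Suc n) = Comp Succ (const_program n)"

lemma run_const_program [simp]: "run (const_program n) x = Some n"
  by (induction n) simp_all

text \<open>The code for \<open>n\<close> results from iterating one map on codes \<open>n\<close>
  times.\<close>

lemma total_computable_goedel_const: "total_computable (\<lambda>n. goedel (const_program n))"
proof -
  have "goedel (const_program n) = ((\<lambda>c. pair 5 (pair (goedel Succ) c)) ^^ n) (goedel Zero)" for n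
    by (induction n) simp_all
  then show ?thesis
    by (simp only:) (intro total_computable_funpow total_computable_basic)
qed

text \<open>The index function of the s-m-n theorem: the first argument is hard-wired by a constant
  program.\<close>

definition smn :: "program \<Rightarrow> nat \<Rightarrow> nat" where
  "smn s n = goedel (Comp s (Pairing (const_program n) (Pairing Fst Snd)))"

lemma phi_smn [simp]: "phi (smn s n) m = run s (pair n m)"
  by (simp add: smn_def phi_goedel del: goedel.simps)

lemma total_computable_smn: "total_computable (smn s)"
  \<comment> \<open>The instantiated equation opens the outer pairing only; the identity keeps its
    code as a constant.\<close>
  unfolding smn_def[abs_def] goedel.simps(5)[of "const_program _"] goedel.simps(6)
  by (intro total_computable_basic total_computable_goedel_const)

section \<open>The operator of a bilayer function\<close>

definition operator :: "'l bilayer \<Rightarrow> nat set \<Rightarrow> nat set" where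
  "operator g p = {x. \<exists>c. (pr1 x, c) \<in> dom (values_at g) \<and>
     pr2 x \<in> imp (the (values_at g (pr1 x, c))) p}"

lemma imp_id: "id_index \<in> imp p p"
  by (simp add: imp_def)

lemma imp_comp: "a \<in> imp q r \<Longrightarrow> b \<in> imp p q \<Longrightarrow> comp_index a b \<in> imp p r"
  unfolding imp_def using phi_comp_index by blast

text \<open>Given \<open>a\<close> from \<open>p\<close> to \<open>q\<close>, the map from
  \<open>\<langle>h, e\<rangle>\<close> to \<open>\<langle>h, a \<circ> e\<rangle>\<close> keeps the
  query and the secret input; \<open>smn\<close> computes its index from \<open>a\<close>.\<close>

lemma computably_monotone_operator: "computably_monotone (operator g)"
proof -
  have "total_computable (\<lambda>z. pair (pr1 (pr2 z)) (comp_index (pr1 z) (pr2 (pr2 z))))"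
    unfolding comp_index_def by (intro total_computable_basic)
  then obtain s where s:
    "\<And>z. run s z = Some (pair (pr1 (pr2 z)) (comp_index (pr1 z) (pr2 (pr2 z))))"
    by (auto simp: total_computable_def)
  obtain t where t: "\<And>a. run t a = Some (smn s a)"
    using total_computable_smn by (auto simp: total_computable_def)
  have "smn s a \<in> imp (operator g p) (operator g q)" if "a \<in> imp p q" for a p q
    unfolding imp_def[of "operator g p"]
    using imp_comp[OF that] by (fastforce simp: s operator_def)
  then show ?thesis
    unfolding computably_monotone_def
    by (intro exI[of _ "goedel t"]) (simp add: phi_goedel t)
qed

section \<open>The operator preserves and reflects the order\<close>

text \<open>The realizer sends \<open>\<langle>n, e\<rangle>\<close> to
  \<open>\<langle>H n, e \<circ> K n\<rangle>\<close>; the secret witness \<open>c\<close> for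
  membership becomes \<open>L n c\<close>.\<close>

lemma le_rea_operator_if_le_LT1:
  assumes "le_LT1 f g"
  shows "le_rea (operator f) (operator g)"
proof -
  obtain H K L where "partial_computable H" "partial_computable2 K"
    and red: "\<And>n c. (n, c) \<in> dom (values_at f) \<Longrightarrow>
      \<exists>h. H n = Some h \<and> (h, L n c) \<in> dom (values_at g) \<and>
        (\<forall>m \<in> the (values_at g (h, L n c)). \<exists>k \<in> the (values_at f (n, c)). K n m = Some k)"
    using assms unfolding le_LT1_def by blast
  then obtain h k where H: "H = run h" and K: "\<And>n m. K n m = run k (pair n m)"
    by (auto simp: partial_computable2_def partial_computable_iff)
  have "total_computable (\<lambda>z. comp_index (pr2 z) (smn k (pr1 z)))"
    unfolding comp_index_def
    by (intro total_computable_basic total_computable_comp[OF total_computable_smn])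
  then obtain t where t: "\<And>z. run t z = Some (comp_index (pr2 z) (smn k (pr1 z)))"
    by (auto simp: total_computable_def)
  have "\<exists>w\<in>operator g p. run (Pairing (Comp h Fst) t) z = Some w" if z: "z \<in> operator f p" for z p
  proof -
    obtain c where c: "(pr1 z, c) \<in> dom (values_at f)"
      "pr2 z \<in> imp (the (values_at f (pr1 z, c))) p"
      using z by (auto simp: operator_def)
    obtain a where a: "run h (pr1 z) = Some a" "(a, L (pr1 z) c) \<in> dom (values_at g)"
      "smn k (pr1 z) \<in> imp (the (values_at g (a, L (pr1 z) c))) (the (values_at f (pr1 z, c)))"
      using red[OF c(1)] by (auto simp: H K imp_def)
    have "pair a (comp_index (pr2 z) (smn k (pr1 z))) \<in> operator g p"
      using a(2) imp_comp[OF c(2) a(3)] by (auto simp: operator_def)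
    then show ?thesis
      using a(1) by (simp add: t)
  qed
  then show ?thesis
    unfolding le_rea_def imp_def
    by (intro exI[of _ "goedel (Pairing (Comp h Fst) t)"]) (simp add: phi_goedel del: goedel.simps)
qed

lemma le_LT1_if_le_rea_operator:
  fixes f :: "'l bilayer" and g :: "'m bilayer"
  assumes "le_rea (operator f) (operator g)"
  shows "le_LT1 f g"
proof -
  obtain e where e: "\<And>p. e \<in> imp (operator f p) (operator g p)"
    using assms by (auto simp: le_rea_def)
  obtain r where r: "phi e = run r"
    using partial_computable_iff[of "phi e"] by (auto simp: partial_computable_def)
  obtain u where u: "\<And>e x y. phi e x = Some y \<Longrightarrow> run u (pair e x) = Some y"
    using universal_program by blast
  \<comment> \<open>\<open>?h\<close> applies the realizer to
    \<open>\<langle>n, id\<rangle>\<close>. The first component of the result is the query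
    \<open>?H n\<close>; the second is a program, which \<open>?K\<close> runs on the answer by
    means of \<open>u\<close>.\<close>
  let ?h = "Comp r (Pairing (Pairing Fst Snd) (const_program id_index))"
  let ?H = "run (Comp Fst ?h)"
  let ?k = "Comp u (Pairing (Comp Snd (Comp ?h Fst)) Snd)"
  let ?K = "\<lambda>n m. run ?k (pair n m)"
  have "\<exists>h c'. ?H n = Some h \<and> (h, c') \<in> dom (values_at g) \<and>
      (\<forall>m \<in> the (values_at g (h, c')). \<exists>k \<in> the (values_at f (n, c)). ?K n m = Some k)"
    if nc: "(n, c) \<in> dom (values_at f)" for n c
  proof -
    let ?p = "the (values_at f (n, c))"
    have "pair n id_index \<in> operator f ?p"
      using nc imp_id by (auto simp: operator_def)
    then obtain w where w: "run r (pair n id_index) = Some w" "w \<in> operator g ?p"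
      using e[of ?p] by (auto simp: imp_def r)
    then obtain c' where c': "(pr1 w, c') \<in> dom (values_at g)"
      "pr2 w \<in> imp (the (values_at g (pr1 w, c'))) ?p"
      by (auto simp: operator_def)
    have "\<exists>k \<in> ?p. ?K n m = Some k" if "m \<in> the (values_at g (pr1 w, c'))" for m
      using c'(2) that u w(1) by (fastforce simp: imp_def)
    then show ?thesis
      using c'(1) w(1) by auto
  qed
  \<comment> \<open>As \<open>e\<close> works for every \<open>p\<close>, the programs do not see
    \<open>c\<close>; all dependence on \<open>c\<close> goes into \<open>L\<close>, which is
    obtained by choice.\<close>
  then obtain L where "\<And>n c. (n, c) \<in> dom (values_at f) \<Longrightarrow>
      \<exists>h. ?H n = Some h \<and> (h, L n c) \<in> dom (values_at g) \<and>
        (\<forall>m \<in> the (values_at g (h, L n c)). \<exists>k \<in> the (values_at f (n, c)). ?K n m = Some k)"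
    by metis
  moreover have "partial_computable ?H"
    by (auto simp only: partial_computable_iff)
  moreover have "partial_computable2 ?K"
    unfolding partial_computable2_def partial_computable_iff by blast
  ultimately show ?thesis
    unfolding le_LT1_def by blast
qed

lemma le_LT1_iff_le_rea: "le_LT1 f g \<longleftrightarrow> le_rea (operator f) (operator g)"
  using le_rea_operator_if_le_LT1 le_LT1_if_le_rea_operator by blast

section \<open>From computably monotone functions back to bilayer functions\<close>

text \<open>The map \<open>\<iota>\<close> places the secret inputs
  \<open>q \<subseteq> \<nat>\<close> inside the universe \<open>'u\<close>; for injective
  \<open>\<iota>\<close>, \<open>inv \<iota>\<close> recovers them.\<close>

definition bilayer_of :: "(nat set \<Rightarrow> 'u) \<Rightarrow> (nat set \<Rightarrow> nat set) \<Rightarrow> 'u bilayer" where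
  "bilayer_of \<iota> \<beta> = \<lparr>secrets = range \<iota>,
     values_at = (\<lambda>(n, c). if c \<in> range \<iota> \<and> n \<in> \<beta> (inv \<iota> c) then Some (inv \<iota> c) else None)\<rparr>"

lemma bilayer_of_in_bilayer_functions: "bilayer_of \<iota> \<beta> \<in> bilayer_functions"
  by (auto simp: bilayer_functions_def bilayer_of_def split: if_splits)

lemma operator_bilayer_of:
  assumes "inj \<iota>"
  shows "operator (bilayer_of \<iota> \<beta>) p = {x. \<exists>q. pr1 x \<in> \<beta> q \<and> pr2 x \<in> imp q p}"
proof -
  have "values_at (bilayer_of \<iota> \<beta>) (n, \<iota> q) = (if n \<in> \<beta> q then Some q else None)" for n q
    using assms by (simp add: bilayer_of_def)
  moreover have "c \<in> range \<iota>" if "(n, c) \<in> dom (values_at (bilayer_of \<iota> \<beta>))" for n c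
    using that by (auto simp: bilayer_of_def split: if_splits)
  ultimately have "(\<exists>c. (n, c) \<in> dom (values_at (bilayer_of \<iota> \<beta>)) \<and>
      P (the (values_at (bilayer_of \<iota> \<beta>) (n, c)))) \<longleftrightarrow> (\<exists>q. n \<in> \<beta> q \<and> P q)" for n P
    by (smt (verit) domD domI option.sel option.distinct(1) rangeE)
  from this[of "pr1 x" "\<lambda>q. pr2 x \<in> imp q p" for x] show ?thesis
    unfolding operator_def by (rule Collect_cong)
qed

text \<open>Send \<open>n\<close> to \<open>\<langle>n, id\<rangle>\<close>, with secret input
  \<open>q = p\<close>.\<close>

lemma le_rea_operator_bilayer_of:
  assumes "inj \<iota>"
  shows "le_rea \<beta> (operator (bilayer_of \<iota> \<beta>))"
proof -
  have "run (Pairing (Pairing Fst Snd) (const_program id_index)) n = Some (pair n id_index)" for n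
    by simp
  moreover have "pair n id_index \<in> operator (bilayer_of \<iota> \<beta>) p" if "n \<in> \<beta> p" for n p
    using that imp_id by (auto simp: operator_bilayer_of[OF assms])
  ultimately show ?thesis
    unfolding le_rea_def imp_def
    by (intro exI[of _ "goedel (Pairing (Pairing Fst Snd) (const_program id_index))"])
      (simp add: phi_goedel del: goedel.simps)
qed

text \<open>For \<open>\<langle>n, e\<rangle>\<close> with \<open>n \<in> \<beta> q\<close> and
  \<open>e\<close> from \<open>q\<close> to \<open>p\<close>, monotonicity turns \<open>e\<close>
  into an index of a map from \<open>\<beta> q\<close> to \<open>\<beta> p\<close>, which the
  universal program runs on \<open>n\<close>.\<close>

lemma operator_bilayer_of_le_rea:
  assumes "inj \<iota>" "computably_monotone \<beta>"
  shows "le_rea (operator (bilayer_of \<iota> \<beta>)) \<beta>"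
proof -
  obtain e where e: "\<And>p q a. a \<in> imp p q \<Longrightarrow> \<exists>b \<in> imp (\<beta> p) (\<beta> q). phi e a = Some b"
    using assms(2) unfolding computably_monotone_def by blast
  obtain r where r: "phi e = run r"
    using partial_computable_iff[of "phi e"] by (auto simp: partial_computable_def)
  obtain u where u: "\<And>e x y. phi e x = Some y \<Longrightarrow> run u (pair e x) = Some y"
    using universal_program by blast
  let ?s = "Comp u (Pairing (Comp r Snd) Fst)"
  have "\<exists>y \<in> \<beta> p. run ?s x = Some y" if x: "x \<in> operator (bilayer_of \<iota> \<beta>) p" for x p
  proof -
    obtain q where q: "pr1 x \<in> \<beta> q" "pr2 x \<in> imp q p"
      using x by (auto simp: operator_bilayer_of[OF assms(1)])
    obtain b where b: "b \<in> imp (\<beta> q) (\<beta> p)" "run r (pr2 x) = Some b"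
      using e[OF q(2)] by (auto simp: r)
    obtain y where "y \<in> \<beta> p" "phi b (pr1 x) = Some y"
      using b(1) q(1) by (auto simp: imp_def)
    then show ?thesis
      using u b(2) by auto
  qed
  then show ?thesis
    unfolding le_rea_def imp_def
    by (intro exI[of _ "goedel ?s"]) (simp add: phi_goedel del: goedel.simps)
qed

lemma le_rea_refl: "le_rea \<alpha> \<alpha>"
  unfolding le_rea_def using imp_id by blast

lemma le_rea_trans: "le_rea \<alpha> \<beta> \<Longrightarrow> le_rea \<beta> \<gamma> \<Longrightarrow> le_rea \<alpha> \<gamma>"
  unfolding le_rea_def using imp_comp by blast

section \<open>Isomorphism of poset reflections\<close>

text \<open>An order-preserving and order-reflecting map that hits every element up to equivalence
  induces an isomorphism of the quotients.\<close>

lemma poset_isomorphic_reflection: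
  assumes refl: "\<And>x. x \<in> B \<Longrightarrow> le' x x"
    and trans: "\<And>x y z. le' x y \<Longrightarrow> le' y z \<Longrightarrow> le' x z"
    and F: "\<And>x. x \<in> A \<Longrightarrow> F x \<in> B"
    and iff: "\<And>x y. le x y \<longleftrightarrow> le' (F x) (F y)"
    and surj: "\<And>y. y \<in> B \<Longrightarrow> \<exists>x\<in>A. le' (F x) y \<and> le' y (F x)"
  shows "poset_isomorphic (reflection A le) (reflection_le le) (reflection B le') (reflection_le le')"
proof -
  define cl where "cl x = induced_equiv A le `` {x}" for x
  define cl' where "cl' y = induced_equiv B le' `` {y}" for y
  \<comment> \<open>The union avoids choosing a representative: all its members coincide when
    \<open>X\<close> is a class.\<close>
  define h where "h X = (\<Union>x\<in>X. cl' (F x))" for X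
  have cl: "cl x = {y \<in> A. le' (F x) (F y) \<and> le' (F y) (F x)}" if "x \<in> A" for x
    using that by (auto simp: cl_def induced_equiv_def iff)
  have cl': "cl' y = {z \<in> B. le' y z \<and> le' z y}" if "y \<in> B" for y
    using that by (auto simp: cl'_def induced_equiv_def)
  have R: "reflection A le = cl ` A" "reflection B le' = cl' ` B"
    by (auto simp: reflection_def quotient_def cl_def cl'_def)
  have in_cl: "x \<in> cl x" if "x \<in> A" for x
    using that by (simp add: cl refl F)
  have in_cl': "y \<in> cl' y" if "y \<in> B" for y
    using that by (simp add: cl' refl)
  have cl'_eq: "cl' y = cl' z" if "y \<in> B" "z \<in> B" "le' y z" "le' z y" for y z
  proof -
    have "le' y w \<longleftrightarrow> le' z w" "le' w y \<longleftrightarrow> le' w z" for w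
      using that(3,4) trans by metis+
    then show ?thesis
      using that(1,2) by (simp add: cl')
  qed
  have h: "h (cl x) = cl' (F x)" if x: "x \<in> A" for x
  proof -
    have "cl' (F y) = cl' (F x)" if "y \<in> cl x" for y
      using that x F by (intro cl'_eq) (auto simp: cl)
    then show ?thesis
      unfolding h_def by (intro UN_constant_eq[OF in_cl[OF x]] ballI)
  qed
  have le: "reflection_le le (cl x) (cl y) \<longleftrightarrow> le' (F x) (F y)" if xy: "x \<in> A" "y \<in> A" for x y
  proof
    assume "reflection_le le (cl x) (cl y)"
    then obtain x' y' where "le' (F x) (F x')" "le' (F x') (F y')" "le' (F y') (F y)"
      using xy by (auto simp: reflection_le_def cl iff)
    then show "le' (F x) (F y)"
      using trans by metis
  next
    assume "le' (F x) (F y)"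
    then show "reflection_le le (cl x) (cl y)"
      using in_cl xy by (auto simp: reflection_le_def iff)
  qed
  have le': "reflection_le le' (cl' x) (cl' y) \<longleftrightarrow> le' x y" if xy: "x \<in> B" "y \<in> B" for x y
  proof
    assume "reflection_le le' (cl' x) (cl' y)"
    then obtain x' y' where "le' x x'" "le' x' y'" "le' y' y"
      using xy by (auto simp: reflection_le_def cl')
    then show "le' x y"
      using trans by metis
  next
    assume "le' x y"
    then show "reflection_le le' (cl' x) (cl' y)"
      using in_cl' xy by (auto simp: reflection_le_def)
  qed
  have "inj_on h (reflection A le)"
  proof (rule inj_onI)
    fix X Y
    assume "X \<in> reflection A le" "Y \<in> reflection A le" and eq: "h X = h Y"
    then obtain x y where xy: "x \<in> A" "X = cl x" "y \<in> A" "Y = cl y"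
      by (auto simp: R)
    have "cl' (F x) = cl' (F y)"
      using eq xy h by simp
    moreover have "F x \<in> cl' (F x)"
      using xy F in_cl' by auto
    ultimately have "le' (F x) (F y)" "le' (F y) (F x)"
      using xy F cl' by auto
    then have "le' (F x) w \<longleftrightarrow> le' (F y) w" "le' w (F x) \<longleftrightarrow> le' w (F y)" for w
      using trans by metis+
    then show "X = Y"
      using xy by (simp add: cl)
  qed
  moreover have "h ` reflection A le = reflection B le'"
  proof -
    have "\<exists>x\<in>A. cl' (F x) = cl' y" if y: "y \<in> B" for y
    proof -
      obtain x where "x \<in> A" "le' (F x) y" "le' y (F x)"
        using surj[OF y] by blast
      then have "cl' (F x) = cl' y"
        using y F by (intro cl'_eq) auto
      with \<open>x \<in> A\<close> show ?thesis ..
    qed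
    then have "cl' ` F ` A = cl' ` B"
      using F by (auto simp: image_iff) metis
    then show ?thesis
      by (simp add: R image_image h cong: image_cong_simp)
  qed
  moreover have "reflection_le le X Y \<longleftrightarrow> reflection_le le' (h X) (h Y)"
    if "X \<in> reflection A le" "Y \<in> reflection A le" for X Y
    using that by (auto simp: R h le le' F)
  ultimately show ?thesis
    unfolding poset_isomorphic_def bij_betw_def by blast
qed

theorem mainTheorem3:
  assumes "\<exists>\<iota> :: nat set \<Rightarrow> 'u. inj \<iota>"
  shows "poset_isomorphic
           (reflection (bilayer_functions :: 'u bilayer set) le_LT1) (reflection_le le_LT1)
           (reflection {\<beta>. computably_monotone \<beta>} le_rea) (reflection_le le_rea)
         \<and> (\<forall>f \<in> (bilayer_functions :: 'v bilayer set).
              \<exists>g \<in> (bilayer_functions :: 'u bilayer set). le_LT1 f g \<and> le_LT1 g f)"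
proof -
  obtain \<iota> :: "nat set \<Rightarrow> 'u" where \<iota>: "inj \<iota>"
    using assms by blast
  note equiv = le_rea_operator_bilayer_of[OF \<iota>] operator_bilayer_of_le_rea[OF \<iota>]
  have "poset_isomorphic
      (reflection (bilayer_functions :: 'u bilayer set) le_LT1) (reflection_le le_LT1)
      (reflection {\<beta>. computably_monotone \<beta>} le_rea) (reflection_le le_rea)"
  proof (rule poset_isomorphic_reflection[where F = operator])
    fix \<beta> :: "nat set \<Rightarrow> nat set"
    assume "\<beta> \<in> {\<beta>. computably_monotone \<beta>}"
    then show "\<exists>x\<in>bilayer_functions :: 'u bilayer set.
        le_rea (operator x) \<beta> \<and> le_rea \<beta> (operator x)"
      using equiv bilayer_of_in_bilayer_functions by blast
  qed (auto simp: le_rea_refl computably_monotone_operator le_LT1_iff_le_rea intro: le_rea_trans)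
  \<comment> \<open>The witness is \<open>bilayer_of \<iota> (operator f)\<close>: its operator is
    equivalent to that of \<open>f\<close>, and operators reflect the order across
    universes.\<close>
  moreover have "\<exists>g \<in> (bilayer_functions :: 'u bilayer set). le_LT1 f g \<and> le_LT1 g f"
    for f :: "'v bilayer"
    using equiv[of "operator f"] computably_monotone_operator bilayer_of_in_bilayer_functions
    unfolding le_LT1_iff_le_rea by blast
  ultimately show ?thesis
    by blast
qed

end
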